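(* Let $t\ge 3$ and let $\alpha'\le\alpha<t-1$ be reals with $\alpha'>\frac{t(\alpha-1)+1}{t-1}$. Then there exists a computable $n_0$ such that for all $n\ge n_0$, every integer degree sequence $D=(d_1,\dots,d_n)$ of length $n$ with minimum degree at least $n^{\alpha'}$ and maximum degree at most $6n^{\alpha}$ has a simple $t$-uniform hypergraph realization if and only if $\sum_{i=1}^n d_i$ is divisible by $t$.
   Context: A simple $t$-uniform hypergraph realization of $D$ is a hypergraph on labelled vertices $v_1,\dots,v_n$ with distinct hyperedges, each consisting of exactly $t$ vertices, in which $v_i$ is contained in exactly $d_i$ hyperedges for every $i$. *)

theory Defs
  imports Complex_Main "HOL-Library.Nat_Bijection"
begin

definition realizes :: "nat \<Rightarrow> nat list \<Rightarrow> nat set set \<Rightarrow> bool" where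
  "realizes t D E \<longleftrightarrow>
     (\<forall>e\<in>E. e \<subseteq> {..<length D} \<and> card e = t) \<and>
     (\<forall>i<length D. card {e \<in> E. i \<in> e} = D ! i)"

definition has_simple_realization :: "nat \<Rightarrow> nat list \<Rightarrow> bool" where
  "has_simple_realization t D \<longleftrightarrow> (\<exists>E. realizes t D E)"

text \<open>
  Partial recursive functions relative to finitely many function oracles. Real numbers are
  given to a program as oracles, in the sense of computable analysis (type-2 computability).
  \<^term>\<open>PrimRec\<close> recurses on the first argument; its step function receives the
  predecessor, the previous value and the parameters, in this order.
\<close>

datatype orec =
    Zero
  | Succ
  | Proj nat
  | Oracle nat
  | Comp orec "orec list"
  | PrimRec orec orec
  | Mu orec

inductive computes :: "(nat \<Rightarrow> nat) list \<Rightarrow> orec \<Rightarrow> nat list \<Rightarrow> nat \<Rightarrow> bool" for os where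
  computes_Zero: "computes os Zero xs 0"
| computes_Succ: "computes os Succ [x] (Suc x)"
| computes_Proj: "i < length xs \<Longrightarrow> computes os (Proj i) xs (xs ! i)"
| computes_Oracle: "i < length os \<Longrightarrow> computes os (Oracle i) [x] ((os ! i) x)"
| computes_Comp: "list_all2 (\<lambda>g y. computes os g xs y) gs ys \<Longrightarrow> computes os f ys z
    \<Longrightarrow> computes os (Comp f gs) xs z"
| computes_PrimRec_0: "computes os f xs y \<Longrightarrow> computes os (PrimRec f g) (0 # xs) y"
| computes_PrimRec_Suc: "computes os (PrimRec f g) (n # xs) r \<Longrightarrow> computes os g (n # r # xs) y
    \<Longrightarrow> computes os (PrimRec f g) (Suc n # xs) y"
| computes_Mu: "computes os f (y # xs) 0 \<Longrightarrow> \<forall>i<y. \<exists>z. computes os f (i # xs) (Suc z)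
    \<Longrightarrow> computes os (Mu f) xs y"

inductive_cases computes_elims:
  "computes os Zero xs y" "computes os Succ xs y" "computes os (Proj i) xs y"
  "computes os (Oracle i) xs y" "computes os (Comp f gs) xs y"
  "computes os (PrimRec f g) (0 # xs) y" "computes os (PrimRec f g) (Suc n # xs) y"
  "computes os (Mu f) xs y"

lemma computes_unique:
  assumes "computes os p xs y" "computes os p xs y'"
  shows "y' = y"
  using assms
proof (induction arbitrary: y' rule: computes.induct)
  case (computes_Comp xs gs ys f z)
  from computes_Comp.prems obtain ys' where
    ys': "list_all2 (\<lambda>g y. computes os g xs y) gs ys'" "computes os f ys' y'"
    by (auto elim: computes_elims)
  have "ys' = ys"
    using computes_Comp.IH(1) ys'(1) by (auto simp: list_all2_conv_all_nth intro!: nth_equalityI)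
  then show ?case
    using computes_Comp.IH(2) ys'(2) by blast
next
  case (computes_Mu f y xs)
  from computes_Mu.prems have y': "computes os f (y' # xs) 0"
    "\<forall>i<y'. \<exists>z. computes os f (i # xs) (Suc z)"
    by (auto elim: computes_elims)
  have "\<not> y < y'"
    using computes_Mu.IH(1) y'(2) by fastforce
  moreover have "\<not> y' < y"
    using computes_Mu.IH(2) y'(1) by fastforce
  ultimately show ?case by simp
qed (blast elim: computes_elims)+

text \<open>
  \<open>\<phi>\<close> lists approximations of \<open>x\<close>: the integer coded by \<open>\<phi> k\<close>, divided
  by \<open>2 ^ k\<close>, has distance at most \<open>1 / 2 ^ k\<close> from \<open>x\<close>.
\<close>

definition real_name :: "(nat \<Rightarrow> nat) \<Rightarrow> real \<Rightarrow> bool" where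
  "real_name \<phi> x \<longleftrightarrow> (\<forall>k. \<bar>real_of_int (int_decode (\<phi> k)) / 2 ^ k - x\<bar> \<le> 1 / 2 ^ k)"

end

theory Submission imports Defs begin

text \<open>
  Divisibility is necessary by double counting. Conversely, let \<open>M\<close> be the sum and \<open>\<Delta>\<close> the maximum
  of the degrees. A realization by \<open>m = M / t\<close> possibly coinciding edges exists as soon as
  \<open>\<Delta> \<le> m\<close>; take one with as many distinct edges as possible. If an edge \<open>e\<close> is repeated, choose
  edges \<open>f\<^sub>2, \<dots>, f\<^sub>t\<close> that are disjoint from each other and from \<open>e\<close>, such that no edge meets all of
  \<open>e, f\<^sub>2, \<dots>, f\<^sub>t\<close>, and replace these \<open>t\<close> edges by \<open>t\<close> disjoint transversals of them: this
  increases the number of distinct edges. Every edge meets at most \<open>t \<Delta>\<close> edges, so there are at least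
  \<open>(m - t\<^sup>2 \<Delta>) ^ (t - 1)\<close> disjoint choices, of which at most \<open>(t \<Delta>) ^ t\<close> have an edge that meets all.
  Hence \<open>M ^ (t - 1) \<ge> (4 t\<^sup>3 \<Delta>) ^ t\<close> suffices.

  With \<open>\<delta> = (t - 1) \<alpha>' - t (\<alpha> - 1) - 1 > 0\<close>, the degree bounds give
  \<open>M ^ (t - 1) \<ge> n powr \<delta> * (\<Delta> / 6) ^ t\<close>, so it is enough that \<open>n powr \<delta> \<ge> (24 t\<^sup>3) ^ t\<close>.
  A program finds \<open>k\<close> with \<open>\<delta> \<ge> 1 / 2 ^ k\<close> by searching for the first approximations of \<open>\<alpha>'\<close> and
  \<open>\<alpha>\<close> that certify it, and returns \<open>(24 t\<^sup>3) ^ (t 2 ^ k)\<close>.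
\<close>

section \<open>Realizations by switching\<close>

text \<open>Greedy counting: at most \<open>k\<close> entries chosen so far exclude at most
  \<open>b\<close> elements each, so every step has at least \<open>m - k * b\<close> choices. This
  gives at least \<open>(m - k * b) ^ k\<close> independent tuples, more than the
  \<open>b ^ Suc k\<close> that can have a common neighbour.\<close>

lemma independent_tuple_without_common_neighbour:
  fixes R :: "nat \<Rightarrow> nat \<Rightarrow> bool"
  assumes refl: "\<And>x. x < m \<Longrightarrow> R x x"
    and sym: "\<And>x y. x < m \<Longrightarrow> y < m \<Longrightarrow> R x y \<Longrightarrow> R y x"
    and deg: "\<And>x. x < m \<Longrightarrow> card {y. y < m \<and> R x y} \<le> b"
    and x0: "x0 < m"
    and large: "b ^ Suc k < (m - k * b) ^ k"
  obtains F :: "nat \<Rightarrow> nat"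
  where "\<And>i. i \<le> k \<Longrightarrow> F i < m" "F k = x0"
    "\<And>i j. i \<le> k \<Longrightarrow> j \<le> k \<Longrightarrow> i \<noteq> j \<Longrightarrow> \<not> R (F i) (F j)"
    "\<And>h. h < m \<Longrightarrow> \<exists>i\<le>k. \<not> R h (F i)"
proof -
  let ?N = "\<lambda>x. {y. y < m \<and> R x y}"
  \<comment> \<open>Tuples grow at the front, so that \<open>x0\<close> stays last and ends up at
    index \<open>k\<close>.\<close>
  define G where "G j = {xs. set xs \<subseteq> {..<m} \<and> length xs = j \<and>
    sorted_wrt (\<lambda>x y. \<not> R x y) (xs @ [x0])}" for j
  have finG: "finite (G j)" for j
    by (rule finite_subset[OF _ finite_lists_length_eq[of "{..<m}" j]]) (auto simp: G_def)
  have step: "card (G j) * (m - k * b) \<le> card (G (Suc j))" if "j < k" for j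
  proof -
    define C where "C xs = {y. y < m \<and> (\<forall>z\<in>set (xs @ [x0]). \<not> R y z)}" for xs
    have finC: "finite (C xs)" for xs
      unfolding C_def by auto
    have "m - k * b \<le> card (C xs)" if "xs \<in> G j" for xs
    proof -
      have sub: "set (xs @ [x0]) \<subseteq> {..<m}"
        using that x0 by (auto simp: G_def)
      have "{..<m} \<subseteq> C xs \<union> (\<Union>z\<in>set (xs @ [x0]). ?N z)"
        using sub sym by (fastforce simp: C_def)
      then have "card {..<m} \<le> card (C xs \<union> (\<Union>z\<in>set (xs @ [x0]). ?N z))"
        using finC by (intro card_mono) auto
      also have "\<dots> \<le> card (C xs) + card (\<Union>z\<in>set (xs @ [x0]). ?N z)"
        by (rule card_Un_le)
      also have "card (\<Union>z\<in>set (xs @ [x0]). ?N z) \<le> (\<Sum>z\<in>set (xs @ [x0]). card (?N z))"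
        by (rule card_UN_le) simp
      also have "\<dots> \<le> card (set (xs @ [x0])) * b"
        using deg sub sum_bounded_above[of "set (xs @ [x0])" "\<lambda>z. card (?N z)" b] by auto
      also have "\<dots> \<le> k * b"
        using card_length[of "xs @ [x0]"] that \<open>j < k\<close> by (intro mult_right_mono) (auto simp: G_def)
      finally show ?thesis by simp
    qed
    then have "card (G j) * (m - k * b) \<le> (\<Sum>xs\<in>G j. card (C xs))"
      using sum_bounded_below[of "G j" "m - k * b" "\<lambda>xs. card (C xs)"] by simp
    also have "\<dots> = card (Sigma (G j) C)"
      using finG finC by simp
    also have "\<dots> \<le> card (G (Suc j))"
      by (rule card_inj_on_le[where f = "\<lambda>(xs, y). y # xs"])
        (use finG in \<open>auto simp: inj_on_def G_def C_def\<close>)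
    finally show ?thesis .
  qed
  have "(m - k * b) ^ j \<le> card (G j)" if "j \<le> k" for j
    using that
  proof (induction j)
    case 0
    have "G 0 = {[]}" by (auto simp: G_def)
    then show ?case by simp
  next
    case (Suc j)
    then have "(m - k * b) ^ Suc j \<le> card (G j) * (m - k * b)"
      by (simp add: mult.commute)
    also have "\<dots> \<le> card (G (Suc j))"
      using step Suc.prems by simp
    finally show ?case .
  qed
  then have many: "b ^ Suc k < card (G k)"
    using large by (meson le_refl less_le_trans)
  \<comment> \<open>A common neighbour \<open>h\<close> is in particular one of the at most
    \<open>b\<close> neighbours of \<open>x0\<close>, and then each of the other \<open>k\<close>
    entries is one of the at most \<open>b\<close> neighbours of \<open>h\<close>.\<close>
  define Bad where "Bad = (\<Union>h\<in>?N x0. {xs. set xs \<subseteq> ?N h \<and> length xs = k})"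
  have finBad: "finite Bad"
    unfolding Bad_def by (auto intro!: finite_lists_length_eq)
  have "card Bad \<le> (\<Sum>h\<in>?N x0. card {xs. set xs \<subseteq> ?N h \<and> length xs = k})"
    unfolding Bad_def by (rule card_UN_le) simp
  also have "\<dots> \<le> (\<Sum>h\<in>?N x0. b ^ k)"
    using deg by (intro sum_mono) (auto simp: card_lists_length_eq intro!: power_mono)
  also have "\<dots> \<le> b ^ Suc k"
    using deg[OF x0] by simp
  finally have "\<not> G k \<subseteq> Bad"
    using many card_mono[OF finBad, of "G k"] by linarith
  then obtain xs where xs: "xs \<in> G k" "xs \<notin> Bad" by blast
  define F where "F i = (xs @ [x0]) ! i" for i
  have len: "length xs = k" and sorted: "sorted_wrt (\<lambda>x y. \<not> R x y) (xs @ [x0])"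
    and sub: "set xs \<subseteq> {..<m}"
    using xs(1) by (auto simp: G_def)
  have Fm: "F i < m" if "i \<le> k" for i
  proof (cases "i = k")
    case False
    then have "xs ! i \<in> set xs" using that len by simp
    with sub have "xs ! i < m" by blast
    then show ?thesis using False that len by (simp add: F_def nth_append)
  qed (use x0 len in \<open>auto simp: F_def nth_append\<close>)
  have less: "\<not> R (F i) (F j)" if "i < j" "j \<le> k" for i j
    using sorted that len unfolding sorted_wrt_iff_nth_less F_def by simp
  show thesis
  proof (rule that)
    show "F k = x0" by (simp add: F_def len[symmetric])
    show "\<not> R (F i) (F j)" if "i \<le> k" "j \<le> k" "i \<noteq> j" for i j
      using less[of i j] less[of j i] sym[of "F i" "F j"] Fm that by (metis linorder_neqE_nat)
    show "\<exists>i\<le>k. \<not> R h (F i)" if h: "h < m" for h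
    proof (rule ccontr)
      assume "\<not> ?thesis"
      then have all: "\<forall>i\<le>k. R h (F i)" by blast
      then have "h \<in> ?N x0"
        using h sym x0 by (auto simp: F_def len[symmetric] nth_append)
      moreover have "set xs \<subseteq> ?N h"
      proof
        fix x assume "x \<in> set xs"
        then obtain i where "i < k" "x = F i"
          using len by (auto simp: in_set_conv_nth F_def nth_append)
        then show "x \<in> ?N h" using all Fm by simp
      qed
      ultimately show False
        using xs(2) len unfolding Bad_def by blast
    qed
  qed (use Fm in auto)
qed

section \<open>Multihypergraphs as arrays of vertices\<close>

definition row :: "nat \<Rightarrow> (nat \<times> nat \<Rightarrow> nat) \<Rightarrow> nat \<Rightarrow> nat set" where
  "row t A r = (\<lambda>c. A (r, c)) ` {..<t}"

text \<open>
  The rows of the \<open>m \<times> t\<close> array \<open>A\<close> are the edges of a multihypergraph with degree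
  sequence \<open>D\<close>, whose edges may coincide but have no repeated vertex.
\<close>

definition arrangement :: "nat \<Rightarrow> nat \<Rightarrow> nat list \<Rightarrow> (nat \<times> nat \<Rightarrow> nat) \<Rightarrow> bool" where
  "arrangement m t D A \<longleftrightarrow>
     (\<forall>r<m. inj_on (\<lambda>c. A (r, c)) {..<t}) \<and>
     (\<forall>p\<in>{..<m} \<times> {..<t}. A p < length D) \<and>
     (\<forall>v<length D. card {p \<in> {..<m} \<times> {..<t}. A p = v} = D ! v)"

lemma finite_row [simp]: "finite (row t A r)"
  by (simp add: row_def)

lemma card_row: "arrangement m t D A \<Longrightarrow> r < m \<Longrightarrow> card (row t A r) = t"
  by (simp add: arrangement_def row_def card_image)

text \<open>The entries of a row are distinct, so \<open>v\<close> fills at most one cell of each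
  row and counting cells is the same as counting rows.\<close>

lemma card_rows_through:
  assumes A: "arrangement m t D A" and v: "v < length D"
  shows "card {r. r < m \<and> v \<in> row t A r} = D ! v"
proof -
  let ?P = "{p \<in> {..<m} \<times> {..<t}. A p = v}"
  have "inj_on fst ?P"
    using A by (auto simp: arrangement_def inj_on_def)
  moreover have "fst ` ?P = {r. r < m \<and> v \<in> row t A r}"
    by (force simp: row_def image_iff)
  ultimately show ?thesis
    using A v card_image[of fst ?P] by (simp add: arrangement_def)
qed

text \<open>Union bound over the \<open>t\<close> vertices of the row. This supplies the degree
  bound \<open>b\<close> for the relation that two rows meet.\<close>

lemma card_rows_meeting:
  assumes A: "arrangement m t D A" and D: "\<forall>d\<in>set D. d \<le> \<Delta>" and r: "r < m"
  shows "card {s. s < m \<and> row t A r \<inter> row t A s \<noteq> {}} \<le> t * \<Delta>"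
proof -
  have sub: "row t A r \<subseteq> {..<length D}"
    using A r by (auto simp: arrangement_def row_def)
  have "{s. s < m \<and> row t A r \<inter> row t A s \<noteq> {}} =
      (\<Union>v\<in>row t A r. {s. s < m \<and> v \<in> row t A s})"
    by auto
  then have "card {s. s < m \<and> row t A r \<inter> row t A s \<noteq> {}} \<le>
      (\<Sum>v\<in>row t A r. card {s. s < m \<and> v \<in> row t A s})"
    by (simp add: card_UN_le)
  also have "\<dots> \<le> card (row t A r) * \<Delta>"
    using sub D card_rows_through[OF A]
    by (intro order.trans[OF sum_bounded_above[where K = \<Delta>]]) auto
  finally show ?thesis
    using card_row[OF A r] by simp
qed

lemma arrangement_of_distinct_rows:
  assumes A: "arrangement m t D A" and inj: "inj_on (row t A) {..<m}"
  shows "has_simple_realization t D"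
proof -
  have "realizes t D (row t A ` {..<m})"
    unfolding realizes_def
  proof (intro conjI allI impI ballI)
    fix e assume "e \<in> row t A ` {..<m}"
    then obtain r where "r < m" "e = row t A r" by auto
    then show "e \<subseteq> {..<length D}" "card e = t"
      using A card_row[OF A] by (auto simp: arrangement_def row_def)
  next
    fix v assume v: "v < length D"
    have "{e \<in> row t A ` {..<m}. v \<in> e} = row t A ` {r. r < m \<and> v \<in> row t A r}"
      by auto
    moreover have "inj_on (row t A) {r. r < m \<and> v \<in> row t A r}"
      using inj by (rule inj_on_subset) auto
    ultimately show "card {e \<in> row t A ` {..<m}. v \<in> e} = D ! v"
      using card_rows_through[OF A v] by (simp add: card_image)
  qed
  then show ?thesis
    by (auto simp: has_simple_realization_def)
qed

text \<open>
  Writing every vertex \<open>v\<close> in \<open>D ! v\<close> consecutive cells, column by column, puts two copies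
  of \<open>v\<close> in the same row only if there are more than \<open>m\<close> of them.
\<close>

lemma arrangement_exists:
  assumes sum: "sum_list D = t * m" and D: "\<forall>d\<in>set D. d \<le> m"
  shows "\<exists>A. arrangement m t D A"
proof -
  define L where "L = concat (map (\<lambda>v. replicate (D ! v) v) [0..<length D])"
  have len: "length L = t * m"
  proof -
    have "length L = sum_list (map ((!) D) [0..<length D])"
      by (simp add: L_def length_concat comp_def)
    then show ?thesis using sum by (simp add: map_nth)
  qed
  have "sorted (concat (map (\<lambda>v. replicate (D ! v) v) [0..<k]))" for k
    by (induction k) (auto simp: sorted_append)
  then have sorted: "sorted L" by (simp add: L_def)
  have "count_list (replicate k x) y = (if x = y then k else 0)" for k and x y :: nat
    by (induction k) auto
  then have "count_list (concat (map (\<lambda>v. replicate (D ! v) v) [0..<k])) v = (if v < k then D ! v else 0)"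
    for k v
    by (induction k) (auto simp: less_Suc_eq)
  then have count: "count_list L v = D ! v" if "v < length D" for v
    using that by (simp add: L_def)
  have card_L: "card {i. i < t * m \<and> L ! i = v} = D ! v" if "v < length D" for v
  proof -
    have "{i. i < t * m \<and> L ! i = v} = {i. i < length L \<and> v = L ! i}"
      using len by auto
    then have "card {i. i < t * m \<and> L ! i = v} = count_list L v"
      by (simp only: count_list_eq_length_filter length_filter_conv_card)
    then show ?thesis using count that by simp
  qed
  have L_less: "L ! i < length D" if "i < t * m" for i
    using nth_mem[of i L] that len by (auto simp: L_def)
  define A where "A = (\<lambda>(r, c). L ! (r + c * m))"
  have cell: "r + c * m < t * m" if "r < m" "c < t" for r c
  proof -
    have "r + c * m < Suc c * m" using that by simp
    also have "\<dots> \<le> t * m" using that by (intro mult_right_mono) auto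
    finally show ?thesis .
  qed
  have bij: "bij_betw (\<lambda>(r, c). r + c * m) ({..<m} \<times> {..<t}) {..<t * m}"
  proof (rule bij_betw_byWitness[where f' = "\<lambda>i. (i mod m, i div m)"])
    show "(\<lambda>i. (i mod m, i div m)) ` {..<t * m} \<subseteq> {..<m} \<times> {..<t}"
    proof (clarsimp)
      fix i assume "i < t * m"
      then show "i mod m < m \<and> i div m < t"
        by (metis less_mult_imp_div_less mod_less_divisor mult_0_right not_gr0 not_less_zero)
    qed
  qed (use cell in \<open>auto\<close>)
  have "inj_on (\<lambda>c. A (r, c)) {..<t}" if r: "r < m" for r
  proof -
    have "A (r, c) \<noteq> A (r, c')" if "c < c'" "c' < t" for c c'
    proof
      assume eq: "A (r, c) = A (r, c')"
      let ?p = "r + c * m" and ?q = "r + c' * m" and ?v = "A (r, c)"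
      have q: "?q < t * m" using cell r that by simp
      have "Suc c * m \<le> c' * m" using that by (intro mult_right_mono) auto
      then have pq: "?p + m \<le> ?q" by simp
      \<comment> \<open>\<open>L\<close> is sorted, so equal values at both ends fill the whole
        interval. It has more than \<open>m\<close> positions, too many for one vertex.\<close>
      have "{?p..?q} \<subseteq> {i. i < t * m \<and> L ! i = ?v}"
      proof
        fix i assume i: "i \<in> {?p..?q}"
        then have "L ! ?p \<le> L ! i" "L ! i \<le> L ! ?q"
          using sorted q len by (auto intro!: sorted_nth_mono)
        then show "i \<in> {i. i < t * m \<and> L ! i = ?v}"
          using eq i q by (auto simp: A_def)
      qed
      then have "card {?p..?q} \<le> card {i. i < t * m \<and> L ! i = ?v}"
        by (intro card_mono) auto
      also have "\<dots> = D ! ?v"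
        using card_L L_less[OF cell[OF r, of c]] that by (simp add: A_def)
      also have "\<dots> \<le> m"
        using D L_less[OF cell[OF r, of c]] that by (simp add: A_def)
      finally show False using pq by simp
    qed
    then show ?thesis
      by (intro inj_onI) (metis lessThan_iff linorder_neqE_nat)
  qed
  moreover have "card {p \<in> {..<m} \<times> {..<t}. A p = v} = D ! v" if v: "v < length D" for v
  proof -
    have "bij_betw (\<lambda>(r, c). r + c * m) {p \<in> {..<m} \<times> {..<t}. A p = v}
        {i. i < t * m \<and> L ! i = v}"
    proof (rule bij_betw_imageI)
      show "inj_on (\<lambda>(r, c). r + c * m) {p \<in> {..<m} \<times> {..<t}. A p = v}"
        using bij_betw_imp_inj_on[OF bij] by (rule inj_on_subset) auto
      have "(\<lambda>(r, c). r + c * m) ` {p \<in> {..<m} \<times> {..<t}. A p = v} =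
          {i \<in> (\<lambda>(r, c). r + c * m) ` ({..<m} \<times> {..<t}). L ! i = v}"
        by (force simp: A_def)
      then show "(\<lambda>(r, c). r + c * m) ` {p \<in> {..<m} \<times> {..<t}. A p = v} =
          {i. i < t * m \<and> L ! i = v}"
        using bij_betw_imp_surj_on[OF bij] by simp
    qed
    then show ?thesis
      using card_L[OF v] by (simp add: bij_betw_same_card)
  qed
  ultimately have "arrangement m t D A"
    using L_less cell by (auto simp: arrangement_def A_def)
  then show ?thesis by blast
qed

section \<open>Switching towards distinct edges\<close>

text \<open>
  If no edge meets all of the \<open>t\<close> disjoint edges \<open>F 0, \<dots>, F (t - 1)\<close>, then the transversal edges
  obtained by transposing the \<open>t \<times> t\<close> block that they form are new. Since \<open>F (t - 1)\<close> occurs twice,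
  at most \<open>t - 1\<close> edges are lost while \<open>t\<close> edges are gained.
\<close>

lemma transpose_block:
  assumes A: "arrangement m t D A" and t: "0 < t"
    and F: "\<And>i. i < t \<Longrightarrow> F i < m"
    and disj: "\<And>i j. i < t \<Longrightarrow> j < t \<Longrightarrow> i \<noteq> j \<Longrightarrow> row t A (F i) \<inter> row t A (F j) = {}"
    and no_common: "\<And>h. h < m \<Longrightarrow> \<exists>i<t. row t A h \<inter> row t A (F i) = {}"
    and dup: "e < m" "e \<noteq> F (t - 1)" "row t A e = row t A (F (t - 1))"
  shows "\<exists>B. arrangement m t D B \<and> card (row t A ` {..<m}) < card (row t B ` {..<m})"
proof -
  have row_ne: "row t A r \<noteq> {}" for r
    using t by (auto simp: row_def)
  have injF: "inj_on F {..<t}"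
    using disj row_ne by (fastforce simp: inj_on_def)
  define G where "G = the_inv_into {..<t} F"
  have GF: "G (F i) = i" if "i < t" for i
    using that injF by (simp add: G_def the_inv_into_f_f)
  \<comment> \<open>An involution on cells: inside the block it exchanges \<open>(F i, c)\<close>
    with \<open>(F c, i)\<close>, elsewhere it is the identity.\<close>
  define \<pi> where "\<pi> = (\<lambda>(r, c). if r \<in> F ` {..<t} \<and> c < t then (F c, G r) else (r, c))"
  have \<pi>_in: "\<pi> p \<in> {..<m} \<times> {..<t}" if "p \<in> {..<m} \<times> {..<t}" for p
    using that F GF by (auto simp: \<pi>_def)
  have \<pi>_\<pi>: "\<pi> (\<pi> p) = p" for p
    using GF by (cases p) (auto simp: \<pi>_def)
  have bij: "bij_betw \<pi> ({..<m} \<times> {..<t}) ({..<m} \<times> {..<t})"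
    by (rule bij_betw_byWitness[where f' = \<pi>])
      (intro ballI image_subsetI \<pi>_\<pi> \<pi>_in; assumption)+
  define B where "B = A \<circ> \<pi>"
  have B_F: "B (F i, c) = A (F c, i)" if "i < t" "c < t" for i c
    using that GF by (auto simp: B_def \<pi>_def)
  have B_other: "B (r, c) = A (r, c)" if "r \<notin> F ` {..<t}" for r c
    using that by (simp add: B_def \<pi>_def)
  have row_F: "row t B (F i) = (\<lambda>c. A (F c, i)) ` {..<t}" if "i < t" for i
    using that B_F by (force simp: row_def)
  have row_other: "row t B r = row t A r" if "r \<notin> F ` {..<t}" for r
    using that B_other by (simp add: row_def)
  have in_row: "A (r, c) \<in> row t A r" if "c < t" for r c
    using that by (simp add: row_def)
  have arr: "arrangement m t D B"
    unfolding arrangement_def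
  proof (intro conjI allI impI ballI)
    fix r assume r: "r < m"
    show "inj_on (\<lambda>c. B (r, c)) {..<t}"
    proof (cases "r \<in> F ` {..<t}")
      case True
      then obtain i where i: "i < t" "r = F i" by auto
      have "A (F c, i) \<noteq> A (F c', i)" if "c < t" "c' < t" "c \<noteq> c'" for c c'
        using disj[OF that] in_row[OF i(1)] by (metis disjoint_iff)
      then show ?thesis
        using i B_F by (auto simp: inj_on_def)
    next
      case False
      then show ?thesis
        using A r B_other by (simp add: arrangement_def)
    qed
  next
    fix p assume "p \<in> {..<m} \<times> {..<t}"
    then show "B p < length D"
      using A \<pi>_in unfolding arrangement_def B_def comp_def by blast
  next
    fix v assume v: "v < length D"
    have "bij_betw \<pi> {p \<in> {..<m} \<times> {..<t}. B p = v} {p \<in> {..<m} \<times> {..<t}. A p = v}"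
      by (rule bij_betw_byWitness[where f' = \<pi>])
        (intro ballI image_subsetI; simp add: B_def \<pi>_in \<pi>_\<pi> del: mem_Sigma_iff)+
    then show "card {p \<in> {..<m} \<times> {..<t}. B p = v} = D ! v"
      using A v by (simp add: bij_betw_same_card arrangement_def)
  qed
  \<comment> \<open>Index \<open>t - 1\<close> is left out of \<open>?lost\<close>: the edge of
    \<open>F (t - 1)\<close> survives as the untouched row \<open>e\<close>.\<close>
  let ?S = "row t A ` {..<m}" and ?lost = "(\<lambda>i. row t A (F i)) ` {..<t - 1}"
    and ?new = "(\<lambda>i. row t B (F i)) ` {..<t}"
  have e_notin: "e \<notin> F ` {..<t}"
  proof
    assume "e \<in> F ` {..<t}"
    then obtain i where "i < t" "e = F i" by auto
    then show False
      using dup disj[of i "t - 1"] row_ne t by (metis Int_absorb diff_less less_one)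
  qed
  \<comment> \<open>A new row takes one cell from each row \<open>F j\<close>, so an old row equal
    to it would meet all of them.\<close>
  have new_fresh: "?new \<inter> ?S = {}"
  proof (rule ccontr)
    assume "?new \<inter> ?S \<noteq> {}"
    then obtain i h where i: "i < t" and h: "h < m" and eq: "row t B (F i) = row t A h" by auto
    obtain j where j: "j < t" "row t A h \<inter> row t A (F j) = {}" using no_common[OF h] by auto
    have "A (F j, i) \<in> row t A h"
      using j i eq row_F by auto
    then show False using j in_row[OF i, of "F j"] by blast
  qed
  \<comment> \<open>A new row meets the old row \<open>F 0\<close> only in the entry of column
    \<open>i\<close>, which determines \<open>i\<close>.\<close>
  have "inj_on (\<lambda>i. row t B (F i)) {..<t}"
  proof (rule inj_onI)
    fix i i' assume i: "i \<in> {..<t}" "i' \<in> {..<t}" and eq: "row t B (F i) = row t B (F i')"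
    then have "A (F 0, i) \<in> row t B (F i')"
      using row_F t by auto
    then obtain c where c: "c < t" "A (F 0, i) = A (F c, i')"
      using row_F i by auto
    then have "c = 0"
      using disj[of 0 c] in_row[of i "F 0"] in_row[of i' "F c"] i t by fastforce
    then show "i = i'"
      using c i A F[OF t] by (auto simp: arrangement_def inj_on_def)
  qed
  then have card_new: "card ?new = t"
    by (simp add: card_image)
  have "?S - ?lost \<subseteq> row t B ` {..<m}"
  proof
    fix s assume s: "s \<in> ?S - ?lost"
    then obtain r where r: "r < m" "s = row t A r" by auto
    show "s \<in> row t B ` {..<m}"
    proof (cases "r \<in> F ` {..<t}")
      case True
      then obtain i where i: "i < t" "r = F i" by auto
      then have "i = t - 1" using s r by force
      then have "s = row t B e"
        using r i dup row_other[OF e_notin] by simp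
      then show ?thesis using dup by auto
    next
      case False
      then show ?thesis using r row_other by auto
    qed
  qed
  moreover have "?new \<subseteq> row t B ` {..<m}"
    using F by auto
  ultimately have "card (?S - ?lost) + card ?new \<le> card (row t B ` {..<m})"
    using new_fresh by (subst card_Un_disjoint[symmetric]) (auto intro!: card_mono)
  moreover have "card ?S - card ?lost \<le> card (?S - ?lost)"
    by (simp add: diff_card_le_card_Diff)
  moreover have "card ?lost \<le> t - 1"
    using card_image_le[of "{..<t - 1}" "\<lambda>i. row t A (F i)"] by simp
  ultimately have "card ?S < card (row t B ` {..<m})"
    using card_new t by linarith
  with arr show ?thesis by blast
qed

text \<open>Here \<open>\<Delta> \<le> m\<close> provides a first arrangement, and
  \<open>large\<close> makes the counting lemma applicable with \<open>b = t * \<Delta>\<close> and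
  \<open>k = t - 1\<close>. An arrangement with the most distinct rows then admits no switch, hence
  has no repeated row.\<close>

lemma realization_exists:
  assumes t: "0 < t" and sum: "sum_list D = t * m" and D: "\<forall>d\<in>set D. d \<le> \<Delta>" and \<Delta>: "\<Delta> \<le> m"
    and large: "(t * \<Delta>) ^ t < (m - t * (t * \<Delta>)) ^ (t - 1)"
  shows "has_simple_realization t D"
proof -
  let ?f = "\<lambda>A. card (row t A ` {..<m})"
  have bound: "?f A \<le> m" for A
    using card_image_le[of "{..<m}" "row t A"] by simp
  obtain A0 where "arrangement m t D A0"
    using arrangement_exists[OF sum] D \<Delta> by fastforce
  then obtain A where A: "arrangement m t D A" and max: "\<And>B. arrangement m t D B \<Longrightarrow> ?f B \<le> ?f A"
    using ex_has_greatest_nat[of "arrangement m t D" A0 ?f "Suc m"] bound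
    by (metis le_imp_less_Suc)
  have "inj_on (row t A) {..<m}"
  proof (rule ccontr)
    assume "\<not> ?thesis"
    then obtain e e' where e: "e < m" "e' < m" "e \<noteq> e'" "row t A e = row t A e'"
      by (auto simp: inj_on_def)
    let ?R = "\<lambda>r s. row t A r \<inter> row t A s \<noteq> {}"
    have row_ne: "row t A r \<noteq> {}" for r
      using t by (auto simp: row_def)
    have "(t * \<Delta>) ^ Suc (t - 1) < (m - (t - 1) * (t * \<Delta>)) ^ (t - 1)"
      using t large by (auto elim!: less_le_trans intro!: power_mono diff_le_mono2)
    with row_ne card_rows_meeting[OF A D] e(2)
    obtain F where F: "\<And>i. i \<le> t - 1 \<Longrightarrow> F i < m" "F (t - 1) = e'"
      "\<And>i j. i \<le> t - 1 \<Longrightarrow> j \<le> t - 1 \<Longrightarrow> i \<noteq> j \<Longrightarrow> \<not> ?R (F i) (F j)"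
      "\<And>h. h < m \<Longrightarrow> \<exists>i\<le>t - 1. \<not> ?R h (F i)"
      by (rule_tac independent_tuple_without_common_neighbour[of m ?R "t * \<Delta>" e' "t - 1"])
        (auto simp: Int_commute)
    have le: "i \<le> t - 1 \<longleftrightarrow> i < t" for i using t by auto
    have "\<exists>B. arrangement m t D B \<and> ?f A < ?f B"
      using F e unfolding le by (intro transpose_block[OF A t, of F e]) blast+
    then show False using max by (meson not_le)
  qed
  with A show ?thesis by (rule arrangement_of_distinct_rows)
qed

lemma dvd_sum_if_realization:
  assumes "has_simple_realization t D"
  shows "t dvd sum_list D"
proof -
  from assms obtain E where E: "realizes t D E"
    by (auto simp: has_simple_realization_def)
  then have fin: "finite E"
    by (intro finite_subset[of E "Pow {..<length D}"]) (auto simp: realizes_def)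
  have "sum_list D = (\<Sum>i<length D. card {e \<in> E. i \<in> e})"
    using E by (simp add: sum_list_sum_nth realizes_def atLeast0LessThan)
  also have "\<dots> = (\<Sum>e\<in>E. card {i \<in> {..<length D}. i \<in> e})"
    using fin by (intro sum_multicount_gen) auto
  also have "\<dots> = (\<Sum>e\<in>E. t)"
  proof (rule sum.cong)
    fix e assume "e \<in> E"
    then have "{i \<in> {..<length D}. i \<in> e} = e" "card e = t"
      using E by (auto simp: realizes_def)
    then show "card {i \<in> {..<length D}. i \<in> e} = t" by simp
  qed simp
  finally show ?thesis by simp
qed

text \<open>Comparing bases at exponent \<open>t - 1\<close> gives
  \<open>4 * t ^ 3 * \<Delta> \<le> t * m\<close>. So \<open>t * (t * \<Delta>)\<close> is at most a
  quarter of \<open>m\<close>, and subtracting it costs at most a factor 2.\<close>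

lemma realization_if_large_sum:
  assumes t: "2 \<le> t" and sum: "sum_list D = t * m" and D: "\<forall>d\<in>set D. d \<le> \<Delta>" and \<Delta>: "0 < \<Delta>"
    and large: "(4 * t ^ 3 * \<Delta>) ^ t \<le> sum_list D ^ (t - 1)"
  shows "has_simple_realization t D"
proof -
  have "(4 * t ^ 3 * \<Delta>) ^ (t - 1) \<le> (4 * t ^ 3 * \<Delta>) ^ t"
    using t \<Delta> by (intro power_increasing) auto
  also note large
  finally have "4 * t ^ 3 * \<Delta> \<le> t * m"
    unfolding sum using t by (subst (asm) power_mono_iff) auto
  then have "t * (4 * t * (t * \<Delta>)) \<le> t * m"
    by (simp add: power3_eq_cube mult_ac)
  then have m: "4 * t * (t * \<Delta>) \<le> m"
    using t by simp
  have "1 * \<Delta> \<le> (4 * t * t) * \<Delta>"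
    using t by (intro mult_right_mono) auto
  also have "\<dots> \<le> m"
    using m by (simp add: mult_ac)
  finally have \<Delta>m: "\<Delta> \<le> m" by simp
  \<comment> \<open>The factor \<open>(2 * t) ^ (t - 1)\<close> is the price of passing from
    \<open>t * m\<close> to \<open>m - t * (t * \<Delta>)\<close>; the constant
    \<open>4 * t ^ 3\<close> is chosen to cover it.\<close>
  have "(t * \<Delta>) ^ t * (2 * t) ^ (t - 1) < (t * \<Delta>) ^ t * (4 * t ^ 2) ^ t"
  proof (intro mult_strict_left_mono)
    have "(2 * t) ^ (t - 1) < (2 * t) ^ t"
      using t by (intro power_strict_increasing) auto
    also have "\<dots> \<le> (4 * t ^ 2) ^ t"
      using t by (intro power_mono) (auto simp: power2_eq_square)
    finally show "(2 * t) ^ (t - 1) < (4 * t ^ 2) ^ t" .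
  qed (use t \<Delta> in auto)
  also have "\<dots> = (4 * t ^ 3 * \<Delta>) ^ t"
    by (simp add: power_mult_distrib[symmetric] power3_eq_cube power2_eq_square mult_ac)
  also have "\<dots> \<le> (t * m) ^ (t - 1)"
    using large sum by simp
  also have "\<dots> \<le> ((m - t * (t * \<Delta>)) * (2 * t)) ^ (t - 1)"
  proof (rule power_mono)
    have "m \<le> 2 * (m - t * (t * \<Delta>))" using m by simp
    then have "t * m \<le> t * (2 * (m - t * (t * \<Delta>)))" by (rule mult_left_mono) simp
    then show "t * m \<le> (m - t * (t * \<Delta>)) * (2 * t)" by (simp only: mult_ac)
  qed simp
  finally have "(t * \<Delta>) ^ t < (m - t * (t * \<Delta>)) ^ (t - 1)"
    unfolding power_mult_distrib[of "m - t * (t * \<Delta>)"] by simp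
  with t sum D \<Delta>m show ?thesis by (intro realization_exists) auto
qed

section \<open>Computability of the threshold\<close>

text \<open>\<open>q\<close> is the number of oracles and \<open>a\<close> the arity. One program
  has to serve all oracles.\<close>

definition total_computable :: "nat \<Rightarrow> nat \<Rightarrow> ((nat \<Rightarrow> nat) list \<Rightarrow> nat list \<Rightarrow> nat) \<Rightarrow> bool" where
  "total_computable q a f \<longleftrightarrow>
     (\<exists>p. \<forall>os xs. length os = q \<longrightarrow> length xs = a \<longrightarrow> computes os p xs (f os xs))"

named_theorems computable

lemma computable_nth [computable]: "i < a \<Longrightarrow> total_computable q a (\<lambda>os xs. xs ! i)"
  unfolding total_computable_def by (auto intro!: exI[of _ "Proj i"] computes_Proj)

lemma computable_comp1:
  assumes "total_computable q 1 (\<lambda>os xs. f os (xs ! 0))" "total_computable q a g"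
  shows "total_computable q a (\<lambda>os xs. f os (g os xs))"
proof -
  from assms obtain pf pg where
    p: "length os = q \<Longrightarrow> length xs = 1 \<Longrightarrow> computes os pf xs (f os (xs ! 0))"
      "length os = q \<Longrightarrow> length xs = a \<Longrightarrow> computes os pg xs (g os xs)" for os xs
    unfolding total_computable_def by blast
  show ?thesis
    unfolding total_computable_def
    using p(1)[of _ "[_]"] p(2)
    by (intro exI[of _ "Comp pf [pg]"] allI impI computes_Comp[where ys = "[_]"]) auto
qed

lemma computable_comp2:
  assumes "total_computable q 2 (\<lambda>os xs. f (xs ! 0) (xs ! 1))"
    "total_computable q a g" "total_computable q a h"
  shows "total_computable q a (\<lambda>os xs. f (g os xs) (h os xs))"
proof -
  from assms obtain pf pg ph where
    p: "length os = q \<Longrightarrow> length xs = 2 \<Longrightarrow> computes os pf xs (f (xs ! 0) (xs ! 1))"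
      "length os = q \<Longrightarrow> length xs = a \<Longrightarrow> computes os pg xs (g os xs)"
      "length os = q \<Longrightarrow> length xs = a \<Longrightarrow> computes os ph xs (h os xs)" for os xs
    unfolding total_computable_def by blast
  show ?thesis
    unfolding total_computable_def
    using p(1)[of _ "[_, _]"] p(2,3)
    by (intro exI[of _ "Comp pf [pg, ph]"] allI impI computes_Comp[where ys = "[_, _]"]) auto
qed

lemma computable_Suc [computable]:
  "total_computable q a f \<Longrightarrow> total_computable q a (\<lambda>os xs. Suc (f os xs))"
proof (erule computable_comp1[rotated])
  show "total_computable q 1 (\<lambda>os xs. Suc (xs ! 0))"
    unfolding total_computable_def
    by (auto intro!: exI[of _ Succ] computes_Succ simp: length_Suc_conv)
qed

lemma computable_oracle [computable]:
  assumes "i < q" "total_computable q a f"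
  shows "total_computable q a (\<lambda>os xs. (os ! i) (f os xs))"
proof (rule computable_comp1[OF _ assms(2)])
  show "total_computable q 1 (\<lambda>os xs. (os ! i) (xs ! 0))"
    unfolding total_computable_def
    using assms(1) by (auto intro!: exI[of _ "Oracle i"] computes_Oracle simp: length_Suc_conv)
qed

lemma computable_const [computable]: "total_computable q a (\<lambda>os xs. c)"
proof (induction c)
  case 0
  show ?case
    unfolding total_computable_def by (auto intro!: exI[of _ Zero] computes_Zero)
qed (rule computable_Suc)

text \<open>\<open>F\<close> enters through its recursion equations, so that existing operations can
  be used directly. The recursion argument comes first.\<close>

lemma computable_primrec:
  assumes f: "total_computable q 1 (\<lambda>os xs. f (xs ! 0))"
    and g: "total_computable q 3 (\<lambda>os xs. g (xs ! 0) (xs ! 1) (xs ! 2))"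
    and F: "\<And>y. F 0 y = f y" "\<And>n y. F (Suc n) y = g n (F n y) y"
    and "total_computable q a h" "total_computable q a k"
  shows "total_computable q a (\<lambda>os xs. F (h os xs) (k os xs))"
proof (rule computable_comp2[OF _ assms(5,6)])
  from f g obtain pf pg where
    p: "length os = q \<Longrightarrow> length xs = 1 \<Longrightarrow> computes os pf xs (f (xs ! 0))"
      "length os = q \<Longrightarrow> length xs = 3 \<Longrightarrow> computes os pg xs (g (xs ! 0) (xs ! 1) (xs ! 2))"
    for os xs
    unfolding total_computable_def by blast
  have "computes os (PrimRec pf pg) [n, y] (F n y)" if "length os = q" for os n y
  proof (induction n)
    case 0
    show ?case using p(1)[of os "[y]"] that F by (auto intro: computes_PrimRec_0)
  next
    case (Suc n)
    then show ?case
      using p(2)[of os "[n, F n y, y]"] that F by (auto intro: computes_PrimRec_Suc)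
  qed
  then show "total_computable q 2 (\<lambda>os xs. F (xs ! 0) (xs ! 1))"
    unfolding total_computable_def
    by (intro exI[of _ "PrimRec pf pg"]) (auto simp: length_Suc_conv numeral_2_eq_2)
qed

lemma computable_add [computable]:
  assumes "total_computable q a f" "total_computable q a g"
  shows "total_computable q a (\<lambda>os xs. f os xs + g os xs)"
  by (rule computable_primrec[of q "\<lambda>y. y" "\<lambda>n r y. Suc r" "(+)", OF _ _ _ _ assms])
    (auto intro!: computable)

lemma computable_mult [computable]:
  assumes "total_computable q a f" "total_computable q a g"
  shows "total_computable q a (\<lambda>os xs. f os xs * g os xs)"
  by (rule computable_primrec[of q "\<lambda>y. 0" "\<lambda>n r y. y + r" "(*)", OF _ _ _ _ assms])
    (auto intro!: computable)

lemma computable_power [computable]: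
  assumes "total_computable q a f" "total_computable q a g"
  shows "total_computable q a (\<lambda>os xs. f os xs ^ g os xs)"
  by (rule computable_primrec[of q "\<lambda>y. 1" "\<lambda>n r y. y * r" "\<lambda>n y. y ^ n", OF _ _ _ _ assms(2,1)])
    (auto intro!: computable simp del: One_nat_def)

lemma computable_diff [computable]:
  assumes "total_computable q a f" "total_computable q a g"
  shows "total_computable q a (\<lambda>os xs. f os xs - g os xs)"
\<comment> \<open>Subtraction iterates the predecessor, which is itself a recursion that returns its
  counter.\<close>
proof (rule computable_primrec[of q "\<lambda>y. y" "\<lambda>n r y. r - 1" "\<lambda>n y. y - n", OF _ _ _ _ assms(2,1)])
  show "total_computable q 3 (\<lambda>os xs. xs ! 1 - 1)"
    by (rule computable_primrec[of q "\<lambda>y. 0" "\<lambda>n r y. n" "\<lambda>n y. n - 1" _ "\<lambda>os xs. xs ! 1"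
          "\<lambda>os xs. 0"])
      (auto intro!: computable)
qed (auto intro!: computable)

lemma computable_mod_2 [computable]:
  assumes "total_computable q a f"
  shows "total_computable q a (\<lambda>os xs. f os xs mod 2)"
  by (rule computable_primrec[of q "\<lambda>y. 0" "\<lambda>n r y. 1 - r" "\<lambda>n y. n mod 2" _ f "\<lambda>os xs. 0"])
    (use assms in \<open>auto intro!: computable simp: mod_Suc simp del: One_nat_def\<close>)

text \<open>Totality of \<open>f\<close> ensures that every trial before the least zero halts with a
  successor, as \<open>Mu\<close> demands. A result is promised only where a zero exists.\<close>

lemma computes_Least:
  assumes "total_computable q (Suc a) f"
  obtains p where "\<And>os xs. length os = q \<Longrightarrow> length xs = a \<Longrightarrow> \<exists>y. f os (y # xs) = 0 \<Longrightarrow>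
    computes os p xs (LEAST y. f os (y # xs) = 0)"
proof -
  from assms obtain p where
    p: "length os = q \<Longrightarrow> length xs = Suc a \<Longrightarrow> computes os p xs (f os xs)" for os xs
    unfolding total_computable_def by blast
  have "computes os (Mu p) xs (LEAST y. f os (y # xs) = 0)"
    if "length os = q" "length xs = a" "\<exists>y. f os (y # xs) = 0" for os xs
  proof (rule computes_Mu)
    have run: "computes os p (i # xs) (f os (i # xs))" for i
      using p that by simp
    then show "computes os p ((LEAST y. f os (y # xs) = 0) # xs) 0"
      using LeastI_ex[OF that(3)] run[of "LEAST y. f os (y # xs) = 0"] by simp
    show "\<forall>i<LEAST y. f os (y # xs) = 0. \<exists>z. computes os p (i # xs) (Suc z)"
    proof (intro allI impI)
      fix i assume "i < (LEAST y. f os (y # xs) = 0)"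
      then have "f os (i # xs) \<noteq> 0" by (rule not_less_Least)
      then show "\<exists>z. computes os p (i # xs) (Suc z)"
        using run[of i] by (cases "f os (i # xs)") auto
    qed
  qed
  then show thesis by (rule that)
qed

section \<open>Certifying a positive gap from approximations\<close>

text \<open>\<open>int_decode\<close> sends an even code \<open>u\<close> to u/2 and an odd one to
  -(u + 1)/2. Doubling avoids the division, and separating the signs keeps all arithmetic in the
  natural numbers.\<close>

definition pos_part :: "nat \<Rightarrow> nat" where
  "pos_part u = u * (1 - u mod 2)"

definition neg_part :: "nat \<Rightarrow> nat" where
  "neg_part u = Suc u * (u mod 2)"

lemma int_decode_parts: "2 * int_decode u = int (pos_part u) - int (neg_part u)"
  by (cases "even u")
    (auto simp: int_decode_def sum_decode_def pos_part_def neg_part_def elim!: evenE oddE)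

text \<open>
  Twice \<open>2 t - ((t - 1) a' - t (a - 2 ^ k) - 2 ^ k)\<close>, truncated at \<open>0\<close>, where \<open>a'\<close> and \<open>a\<close> are
  the integers coded by \<open>\<phi>' k\<close> and \<open>\<phi> k\<close>. Replacing \<open>a'\<close> by \<open>2 ^ k \<alpha>'\<close> and \<open>a\<close> by \<open>2 ^ k \<alpha>\<close>
  changes the inner term by at most \<open>2 t - 1\<close>.
\<close>

definition gap_test :: "(nat \<Rightarrow> nat) \<Rightarrow> (nat \<Rightarrow> nat) \<Rightarrow> nat \<Rightarrow> nat \<Rightarrow> nat" where
  "gap_test \<phi>' \<phi> k t =
     (4 * t + (t - 1) * neg_part (\<phi>' k) + t * pos_part (\<phi> k)) -
     ((t - 1) * pos_part (\<phi>' k) + t * neg_part (\<phi> k) + 2 * (t - 1) * 2 ^ k)"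

lemma computable_gap_test:
  "total_computable 2 2 (\<lambda>os xs. gap_test (os ! 0) (os ! 1) (xs ! 0) (xs ! 1))"
  unfolding gap_test_def pos_part_def neg_part_def by (intro computable; simp)+

text \<open>The \<delta> of the overview: \<open>t - 1\<close> times the amount by which \<alpha>'
  exceeds its lower bound in the theorem.\<close>

definition gap :: "nat \<Rightarrow> real \<Rightarrow> real \<Rightarrow> real" where
  "gap t \<alpha>' \<alpha> = (real t - 1) * \<alpha>' - real t * (\<alpha> - 1) - 1"

text \<open>Truncated subtraction vanishes exactly if the minuend is at most the subtrahend; moving
  the negative parts across and halving gives the real inequality.\<close>

lemma gap_test_eq_0_iff:
  assumes "0 < t"
  shows "gap_test \<phi>' \<phi> k t = 0 \<longleftrightarrow>
    2 * real t \<le> (real t - 1) * int_decode (\<phi>' k) - real t * int_decode (\<phi> k) + (real t - 1) * 2 ^ k"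
proof -
  have parts: "2 * real_of_int (int_decode u) = real (pos_part u) - real (neg_part u)" for u
    using arg_cong[OF int_decode_parts, of real_of_int] by simp
  have t_minus_1: "real (t - 1) = real t - 1"
    using assms by (simp add: of_nat_diff)
  have "gap_test \<phi>' \<phi> k t = 0 \<longleftrightarrow>
      real (4 * t + (t - 1) * neg_part (\<phi>' k) + t * pos_part (\<phi> k)) \<le>
      real ((t - 1) * pos_part (\<phi>' k) + t * neg_part (\<phi> k) + 2 * (t - 1) * 2 ^ k)"
    unfolding gap_test_def of_nat_le_iff by simp
  also have "\<dots> \<longleftrightarrow> 4 * real t \<le> (real t - 1) * (2 * real_of_int (int_decode (\<phi>' k)))
      - real t * (2 * real_of_int (int_decode (\<phi> k))) + 2 * (real t - 1) * 2 ^ k"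
    unfolding parts of_nat_add of_nat_mult of_nat_power t_minus_1 by (simp add: algebra_simps)
  also have "\<dots> \<longleftrightarrow> 2 * real t \<le>
      (real t - 1) * int_decode (\<phi>' k) - real t * int_decode (\<phi> k) + (real t - 1) * 2 ^ k"
    by (intro iffI; simp add: algebra_simps)
  finally show ?thesis .
qed

text \<open>After scaling by \<open>2 ^ k\<close> each approximation is off by at most 1, and the
  weights \<open>t - 1\<close> and \<open>t\<close> add up to \<open>2 * t - 1\<close>.\<close>

lemma gap_approximation:
  assumes names: "real_name \<phi>' \<alpha>'" "real_name \<phi> \<alpha>" and t: "0 < t"
  shows "\<bar>(real t - 1) * int_decode (\<phi>' k) - real t * int_decode (\<phi> k) + (real t - 1) * 2 ^ k
    - 2 ^ k * gap t \<alpha>' \<alpha>\<bar> \<le> 2 * real t - 1"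
proof -
  have approx: "\<bar>real_of_int (int_decode (\<psi> k)) - 2 ^ k * x\<bar> \<le> 1" if "real_name \<psi> x" for \<psi> x
  proof -
    have "\<bar>real_of_int (int_decode (\<psi> k)) / 2 ^ k - x\<bar> * 2 ^ k \<le> 1 / 2 ^ k * 2 ^ k"
      using that unfolding real_name_def by (intro mult_right_mono) auto
    also have "\<bar>real_of_int (int_decode (\<psi> k)) / 2 ^ k - x\<bar> * 2 ^ k =
        \<bar>(real_of_int (int_decode (\<psi> k)) / 2 ^ k - x) * 2 ^ k\<bar>"
      by (simp add: abs_mult)
    also have "(real_of_int (int_decode (\<psi> k)) / 2 ^ k - x) * 2 ^ k = int_decode (\<psi> k) - 2 ^ k * x"
      by (simp add: field_simps)
    finally show ?thesis by simp
  qed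
  let ?x = "int_decode (\<phi>' k) - 2 ^ k * \<alpha>'" and ?y = "int_decode (\<phi> k) - 2 ^ k * \<alpha>"
  have "(real t - 1) * int_decode (\<phi>' k) - real t * int_decode (\<phi> k) + (real t - 1) * 2 ^ k
      - 2 ^ k * gap t \<alpha>' \<alpha> = (real t - 1) * ?x - real t * ?y"
    by (simp add: gap_def algebra_simps)
  also have "\<bar>\<dots>\<bar> \<le> \<bar>(real t - 1) * ?x\<bar> + \<bar>real t * ?y\<bar>"
    by (rule abs_triangle_ineq4)
  also have "\<dots> \<le> (real t - 1) * 1 + real t * 1"
    unfolding abs_mult using approx[OF names(1)] approx[OF names(2)] t
    by (intro add_mono mult_mono) auto
  finally show ?thesis by simp
qed

text \<open>The cutoff \<open>2 * t\<close> of the test exceeds the approximation error by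
  1.\<close>

lemma gap_test_sound:
  assumes "real_name \<phi>' \<alpha>'" "real_name \<phi> \<alpha>" "0 < t" "gap_test \<phi>' \<phi> k t = 0"
  shows "1 \<le> 2 ^ k * gap t \<alpha>' \<alpha>"
  using gap_approximation[OF assms(1-3), of k] gap_test_eq_0_iff[OF assms(3)] assms(4) by fastforce

lemma gap_test_complete:
  assumes "real_name \<phi>' \<alpha>'" "real_name \<phi> \<alpha>" "0 < t" "0 < gap t \<alpha>' \<alpha>"
  shows "\<exists>k. gap_test \<phi>' \<phi> k t = 0"
proof -
  \<comment> \<open>\<open>4 * t\<close> exceeds the sum of the cutoff \<open>2 * t\<close> and the
    error \<open>2 * t - 1\<close>.\<close>
  obtain k where "4 * real t / gap t \<alpha>' \<alpha> < 2 ^ k"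
    using real_arch_pow[of 2 "4 * real t / gap t \<alpha>' \<alpha>"] by auto
  then have "4 * real t < 2 ^ k * gap t \<alpha>' \<alpha>"
    using assms(4) by (simp add: field_simps)
  then have "gap_test \<phi>' \<phi> k t = 0"
    using gap_approximation[OF assms(1-3), of k] gap_test_eq_0_iff[OF assms(3)] by fastforce
  then show ?thesis ..
qed

definition threshold :: "nat \<Rightarrow> nat \<Rightarrow> nat" where
  "threshold k t = (24 * t ^ 3) ^ (t * 2 ^ k)"

text \<open>One program serves all \<open>t\<close> and all names. The \<open>k\<close> it finds
  depends on the names and not just on the reals, so it is chosen after them.\<close>

lemma threshold_program:
  "\<exists>p. \<forall>t \<alpha>' \<alpha> \<phi>' \<phi>. 0 < t \<longrightarrow> 0 < gap t \<alpha>' \<alpha> \<longrightarrow> real_name \<phi>' \<alpha>' \<longrightarrow> real_name \<phi> \<alpha> \<longrightarrow>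
     (\<exists>k. computes [\<phi>', \<phi>] p [t] (threshold k t) \<and> 1 \<le> 2 ^ k * gap t \<alpha>' \<alpha>)"
proof -
  have "total_computable 2 (Suc 1) (\<lambda>os xs. gap_test (os ! 0) (os ! 1) (xs ! 0) (xs ! 1))"
    using computable_gap_test by (simp add: numeral_2_eq_2)
  then obtain p where p: "\<And>os xs. length os = 2 \<Longrightarrow> length xs = 1 \<Longrightarrow>
      \<exists>k. gap_test (os ! 0) (os ! 1) k (xs ! 0) = 0 \<Longrightarrow>
      computes os p xs (LEAST k. gap_test (os ! 0) (os ! 1) k (xs ! 0) = 0)"
    by (rule computes_Least) auto
  have "total_computable 2 2 (\<lambda>os xs. threshold (xs ! 0) (xs ! 1))"
    unfolding threshold_def by (intro computable; simp)+
  then obtain p' where p': "\<And>os xs. length os = 2 \<Longrightarrow> length xs = 2 \<Longrightarrow>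
      computes os p' xs (threshold (xs ! 0) (xs ! 1))"
    unfolding total_computable_def by blast
  show ?thesis
  \<comment> \<open>\<open>p\<close> searches for \<open>k\<close>, \<open>Proj 0\<close> passes
    \<open>t\<close> on, and \<open>p'\<close> evaluates the threshold at both.\<close>
  proof (intro exI[of _ "Comp p' [p, Proj 0]"] allI impI)
    fix t \<alpha>' \<alpha> \<phi>' \<phi>
    assume t: "0 < t" and gap: "0 < gap t \<alpha>' \<alpha>" and names: "real_name \<phi>' \<alpha>'" "real_name \<phi> \<alpha>"
    define k where "k = (LEAST k. gap_test \<phi>' \<phi> k t = 0)"
    have ex: "\<exists>k. gap_test \<phi>' \<phi> k t = 0"
      using gap_test_complete[OF names t gap] .
    then have "computes [\<phi>', \<phi>] p [t] k"
      using p[of "[\<phi>', \<phi>]" "[t]"] by (simp add: k_def)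
    then have "computes [\<phi>', \<phi>] (Comp p' [p, Proj 0]) [t] (threshold k t)"
      using p'[of "[\<phi>', \<phi>]" "[k, t]"] computes_Proj[of 0 "[t]"]
      by (intro computes_Comp[where ys = "[k, t]"]) auto
    moreover have "gap_test \<phi>' \<phi> k t = 0"
      using ex unfolding k_def by (rule LeastI_ex)
    ultimately show "\<exists>k. computes [\<phi>', \<phi>] (Comp p' [p, Proj 0]) [t] (threshold k t) \<and>
        1 \<le> 2 ^ k * gap t \<alpha>' \<alpha>"
      using gap_test_sound[OF names t] by blast
  qed
qed

section \<open>Degree sequences above the threshold\<close>

lemma realization_above_threshold:
  assumes t: "2 \<le> t" and gap: "1 \<le> 2 ^ k * gap t \<alpha>' \<alpha>" and n: "threshold k t \<le> length D"
    and lower: "\<forall>d\<in>set D. real (length D) powr \<alpha>' \<le> real d"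
    and upper: "\<forall>d\<in>set D. real d \<le> 6 * real (length D) powr \<alpha>"
    and dvd: "t dvd sum_list D"
  shows "has_simple_realization t D"
proof -
  define \<delta> where "\<delta> = gap t \<alpha>' \<alpha>"
  define N where "N = real (length D)"
  have \<delta>: "0 < \<delta>"
    using gap unfolding \<delta>_def by (smt (verit) mult_nonneg_nonpos zero_le_power)
  have "0 < threshold k t"
    using t by (simp add: threshold_def)
  then have "D \<noteq> []" and N: "0 < N"
    using n by (auto simp: N_def)
  define \<Delta> where "\<Delta> = Max (set D)"
  have \<Delta>_in: "\<Delta> \<in> set D" and \<Delta>_max: "\<forall>d\<in>set D. d \<le> \<Delta>"
    using \<open>D \<noteq> []\<close> by (auto simp: \<Delta>_def)
  \<comment> \<open>A power of \<open>N > 0\<close> is positive whatever the sign of \<alpha>', so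
    all degrees are positive.\<close>
  have \<Delta>: "0 < \<Delta>"
  proof -
    have "0 < N powr \<alpha>'" using N by simp
    also have "\<dots> \<le> real \<Delta>" using lower \<Delta>_in by (simp add: N_def)
    finally show ?thesis by simp
  qed
  have sum: "N * N powr \<alpha>' \<le> real (sum_list D)"
    unfolding N_def using lower sum_bounded_below[of "{..<length D}" "N powr \<alpha>'" "\<lambda>i. real (D ! i)"]
    by (simp add: sum_list_sum_nth atLeast0LessThan N_def)
  let ?B = "24 * real t ^ 3"
  have B: "1 \<le> ?B" using t one_le_power[of "real t" 3] by linarith
  have "?B ^ t \<le> ?B powr (real (t * 2 ^ k) * \<delta>)"
  proof -
    have "real t * 1 \<le> real t * (2 ^ k * \<delta>)"
      using gap by (intro mult_left_mono) (auto simp: \<delta>_def)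
    then have "?B powr real t \<le> ?B powr (real (t * 2 ^ k) * \<delta>)"
      using B by (intro powr_mono) (auto simp: mult_ac)
    moreover have "?B powr real t = ?B ^ t"
      using B by (intro powr_realpow) linarith
    ultimately show ?thesis by (simp only:)
  qed
  also have "\<dots> = (?B ^ (t * 2 ^ k)) powr \<delta>"
  proof -
    have "?B powr real (t * 2 ^ k) = ?B ^ (t * 2 ^ k)"
      using B by (intro powr_realpow) linarith
    then show ?thesis by (simp only: powr_powr[symmetric])
  qed
  also have "\<dots> \<le> N powr \<delta>"
  proof (rule powr_mono2)
    have "real (threshold k t) \<le> N" using n by (simp add: N_def)
    then show "?B ^ (t * 2 ^ k) \<le> N" by (simp add: threshold_def)
  qed (use \<delta> B in auto)
  finally have N\<delta>: "?B ^ t \<le> N powr \<delta>" .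
  \<comment> \<open>Here 24 = 4 * 6: the 6 of the upper degree bound moves into the constant,
    leaving \<open>\<Delta> / 6\<close>, which is at most \<open>N powr \<alpha>\<close>.\<close>
  have "real (4 * t ^ 3 * \<Delta>) = real \<Delta> / 6 * ?B"
    by simp
  then have "real ((4 * t ^ 3 * \<Delta>) ^ t) = (real \<Delta> / 6) ^ t * ?B ^ t"
    by (simp only: of_nat_power power_mult_distrib[of "real \<Delta> / 6" ?B])
  also have "\<dots> \<le> (N powr \<alpha>) ^ t * N powr \<delta>"
    using N\<delta> upper \<Delta>_in B by (intro mult_mono power_mono) (auto simp: N_def)
  also have "\<dots> = N powr (real t * \<alpha> + \<delta>)"
    using N powr_realpow[of "N powr \<alpha>" t] by (simp add: powr_add powr_powr mult.commute)
  \<comment> \<open>The gap is defined so that the two exponents of \<open>N\<close> agree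
    here.\<close>
  also have "real t * \<alpha> + \<delta> = (1 + \<alpha>') * real (t - 1)"
    using t by (simp add: \<delta>_def gap_def of_nat_diff algebra_simps)
  also have "N powr \<dots> = (N * N powr \<alpha>') ^ (t - 1)"
  proof -
    have "(N powr (1 + \<alpha>')) powr real (t - 1) = (N powr (1 + \<alpha>')) ^ (t - 1)"
      using N by (intro powr_realpow) simp
    moreover have "N powr (1 + \<alpha>') = N * N powr \<alpha>'"
      using N by (simp add: powr_add)
    ultimately show ?thesis by (simp only: powr_powr[symmetric])
  qed
  also have "\<dots> \<le> real (sum_list D) ^ (t - 1)"
    using sum N by (intro power_mono) auto
  finally have "(4 * t ^ 3 * \<Delta>) ^ t \<le> sum_list D ^ (t - 1)"
    by (metis of_nat_le_iff of_nat_power)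
  moreover obtain m where "sum_list D = t * m" using dvd by (auto elim: dvdE)
  ultimately show ?thesis
    using t \<Delta> \<Delta>_max by (intro realization_if_large_sum) auto
qed

theorem theorem3:
  "\<exists>prog :: orec. \<forall>(t :: nat) (\<alpha>' :: real) (\<alpha> :: real).
     3 \<le> t \<longrightarrow> \<alpha>' \<le> \<alpha> \<longrightarrow> \<alpha> < real t - 1 \<longrightarrow>
     \<alpha>' > (real t * (\<alpha> - 1) + 1) / (real t - 1) \<longrightarrow>
     (\<forall>\<phi>' \<phi>. real_name \<phi>' \<alpha>' \<longrightarrow> real_name \<phi> \<alpha> \<longrightarrow>
       (\<exists>n\<^sub>0. computes [\<phi>', \<phi>] prog [t] n\<^sub>0 \<and>
         (\<forall>n\<ge>n\<^sub>0. \<forall>D :: nat list.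
            length D = n \<longrightarrow>
            (\<forall>d\<in>set D. real n powr \<alpha>' \<le> real d) \<longrightarrow>
            (\<forall>d\<in>set D. real d \<le> 6 * real n powr \<alpha>) \<longrightarrow>
            (has_simple_realization t D \<longleftrightarrow> t dvd sum_list D))))"
proof -
  obtain p where p: "\<forall>t \<alpha>' \<alpha> \<phi>' \<phi>. 0 < t \<longrightarrow> 0 < gap t \<alpha>' \<alpha> \<longrightarrow> real_name \<phi>' \<alpha>' \<longrightarrow> real_name \<phi> \<alpha> \<longrightarrow>
      (\<exists>k. computes [\<phi>', \<phi>] p [t] (threshold k t) \<and> 1 \<le> 2 ^ k * gap t \<alpha>' \<alpha>)"
    using threshold_program by (elim exE)
  show ?thesis
  proof (rule exI[of _ p], intro allI impI)
    fix t :: nat and \<alpha>' \<alpha> :: real and \<phi>' \<phi> :: "nat \<Rightarrow> nat"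
    assume t: "3 \<le> t" and \<alpha>': "(real t * (\<alpha> - 1) + 1) / (real t - 1) < \<alpha>'"
      and names: "real_name \<phi>' \<alpha>'" "real_name \<phi> \<alpha>"
    have "0 < real t - 1" "0 < t" using t by auto
    then have "0 < gap t \<alpha>' \<alpha>"
      using \<alpha>' by (simp add: gap_def pos_divide_less_eq mult.commute)
    with p names \<open>0 < t\<close> obtain k where
      k: "computes [\<phi>', \<phi>] p [t] (threshold k t)" "1 \<le> 2 ^ k * gap t \<alpha>' \<alpha>"
      by blast
    have "has_simple_realization t D \<longleftrightarrow> t dvd sum_list D"
      if "threshold k t \<le> n" "length D = n" "\<forall>d\<in>set D. real n powr \<alpha>' \<le> real d"
        "\<forall>d\<in>set D. real d \<le> 6 * real n powr \<alpha>" for n D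
      using realization_above_threshold[OF _ k(2), of D] dvd_sum_if_realization[of t D] that t
      by auto
    then show "\<exists>n\<^sub>0. computes [\<phi>', \<phi>] p [t] n\<^sub>0 \<and>
         (\<forall>n\<ge>n\<^sub>0. \<forall>D :: nat list.
            length D = n \<longrightarrow>
            (\<forall>d\<in>set D. real n powr \<alpha>' \<le> real d) \<longrightarrow>
            (\<forall>d\<in>set D. real d \<le> 6 * real n powr \<alpha>) \<longrightarrow>
            (has_simple_realization t D \<longleftrightarrow> t dvd sum_list D))"
      using k(1) by blast
  qed
qed

end
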